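(* Let $T$ be an element of an affine partition, let $0\le K\le k$ be integers, and suppose an embedded hierarchical nodal basis of degree $K$ consisting of Lagrange polynomials is given, the Lagrange nodes being the quadrature nodes ($\mathcal{N}=\mathcal{Q}$). Then: 1. $P_h^{K,k}$ is a linear operator. 2. For an arbitrary norm $\|\cdot\|$ on $V_h^{K,k}(T)$ there is a constant $C(K,k,\|\cdot\|)$ such that $\|P_h^{K,k}v\|\le C(K,k,\|\cdot\|)\,\|v\|_{0,\infty,T}$ for all $v\in C^0(T)$. 3. For $m\in\mathbb{N}$ and $v\in\mathbb{Q}_k(T)$, $$\big(P_h'(\nabla v),P_h'(\nabla v^{2m-1})\big)_{0,T,h}\ge 0 .$$
   Context: $\hat T:=[-1,1]^d$, $T=F_T(\hat T)$ with $F_T$ affine and invertible. $\mathbb{Q}_k(\hat T)$ is the span of $\hat x^\alpha$, $\|\alpha\|_{\ell^\infty}\le k$, and $\mathbb{Q}_k(T)=\{\hat v\circ F_T^{-1}:\hat v\in\mathbb{Q}_k(\hat T)\}$. $\|\cdot\|_{0,\infty,T}$ is the $L^\infty(T)$-norm. Nodes and discrete inner product: let $n_k=(k+1)^d$ and let $x_1,\dots,x_{n_k}\in T$ be the images under $F_T$ of a tensor-product grid of $(k+1)^d$ distinct nodes of $\hat T$; let $\mathcal{B}_k=\{\varphi_1,\dots,\varphi_{n_k}\}$ be the Lagrange basis of $\mathbb{Q}_k(T)$ with respect to these nodes, $\varphi_i(x_j)=\delta_{ij}$. The quadrature rule has the same nodes and the weights $\omega_i^J=\int_T\varphi_i\,dx$,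 assumed positive; $(v,w)_{0,T,h}:=\sum_{i=1}^{n_k}\omega_i^Jv(x_i)w(x_i)$, where for vector-valued functions the product $v(x_i)w(x_i)$ is replaced by the Euclidean inner product. Embedded hierarchical nodal basis of degree $K$: with a suitable numbering, the first $n_K=(K+1)^d$ nodes $x_1,\dots,x_{n_K}$ are the node set of a Lagrange basis $\tilde{\mathcal{B}}_K$ of $\mathbb{Q}_K(T)$; $\mathcal{B}_K:=\{\varphi_1,\dots,\varphi_{n_K}\}\subset\mathcal{B}_k$ is the set of those degree-$k$ Lagrange polynomials belonging to these nodes. Put $V_h^{K,k}(T):=\operatorname{span}\mathcal{B}_K$. The projector $P_h^{K,k}$ maps a continuous function $v$ on $T$ to the element $P_h^{K,k}v\in V_h^{K,k}(T)$ with $(v-P_h^{K,k}v,w)_{0,T,h}=0$ for all $w\in V_h^{K,k}(T)$. The fluctuation operator is $P_h':=\mathrm{Id}-P_h^{K,k}$. Both operators act componentwise on vector-valued functions. $\nabla v^{2m-1}$ denotes $\nabla(v^{2m-1})$. *)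

theory Defs
  imports "HOL-Analysis.Analysis" "HOL-Probability.Essential_Supremum"
begin

text \<open>
  Functions on an element are represented by total functions on \<open>real ^ 'n\<close>.  Elements of the
  polynomial spaces are polynomial functions on the whole space; since an element has nonempty
  interior, such a function is determined by its values on the element.
\<close>

definition lin_span :: "('i \<Rightarrow> 'a \<Rightarrow> real) \<Rightarrow> 'i set \<Rightarrow> ('a \<Rightarrow> real) set"
  where "lin_span \<phi> I = {v. \<exists>c. v = (\<lambda>y. \<Sum>i\<in>I. c i * \<phi> i y)}"

definition ref_cube :: "(real ^ 'n) set"
  where "ref_cube = cbox (\<chi> j. - 1) (\<chi> j. 1)"

definition affine_iso :: "(real ^ 'n \<Rightarrow> real ^ 'n) \<Rightarrow> bool"
  where "affine_iso F \<longleftrightarrow> (\<exists>L b. linear L \<and> bij L \<and> F = (\<lambda>y. L y + b))"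

definition Q_ref :: "nat \<Rightarrow> (real ^ 'n \<Rightarrow> real) set"
  where "Q_ref k = lin_span (\<lambda>\<alpha> y. \<Prod>j\<in>UNIV. (y $ j) ^ \<alpha> j) {\<alpha> :: 'n \<Rightarrow> nat. \<forall>j. \<alpha> j \<le> k}"

definition Q_elem :: "(real ^ 'n \<Rightarrow> real ^ 'n) \<Rightarrow> nat \<Rightarrow> (real ^ 'n \<Rightarrow> real) set"
  where "Q_elem F k = {v \<circ> inv F | v. v \<in> Q_ref k}"

definition tensor_grid :: "nat \<Rightarrow> (real ^ 'n) set \<Rightarrow> bool"
  where "tensor_grid k G \<longleftrightarrow>
    (\<exists>\<xi> :: 'n \<Rightarrow> nat \<Rightarrow> real.
       (\<forall>j. inj_on (\<xi> j) {..k} \<and> \<xi> j ` {..k} \<subseteq> {- 1..1}) \<and>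
       G = {(\<chi> j. \<xi> j (\<alpha> j)) | \<alpha>. \<forall>j. \<alpha> j \<le> k})"

text \<open>
  The duality condition forces linear independence, so that spanning makes \<open>\<phi>\<close> a basis of \<open>V\<close>.
\<close>

definition lagrange_basis ::
    "('a \<Rightarrow> real) set \<Rightarrow> nat \<Rightarrow> (nat \<Rightarrow> 'a) \<Rightarrow> (nat \<Rightarrow> 'a \<Rightarrow> real) \<Rightarrow> bool"
  where "lagrange_basis V n x \<phi> \<longleftrightarrow>
    lin_span \<phi> {1..n} = V \<and>
    (\<forall>i\<in>{1..n}. \<forall>j\<in>{1..n}. \<phi> i (x j) = (if i = j then 1 else 0))"

definition quad_weight :: "(real ^ 'n) set \<Rightarrow> (nat \<Rightarrow> real ^ 'n \<Rightarrow> real) \<Rightarrow> nat \<Rightarrow> real"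
  where "quad_weight T \<phi> i = (LINT y:T|lebesgue. \<phi> i y)"

definition disc_inner ::
    "(real ^ 'n) set \<Rightarrow> nat \<Rightarrow> (nat \<Rightarrow> real ^ 'n) \<Rightarrow> (nat \<Rightarrow> real ^ 'n \<Rightarrow> real) \<Rightarrow>
     (real ^ 'n \<Rightarrow> 'b::real_inner) \<Rightarrow> (real ^ 'n \<Rightarrow> 'b) \<Rightarrow> real"
  where "disc_inner T n x \<phi> v w = (\<Sum>i=1..n. quad_weight T \<phi> i * (v (x i) \<bullet> w (x i)))"

definition hier_space :: "nat \<Rightarrow> (nat \<Rightarrow> 'a \<Rightarrow> real) \<Rightarrow> ('a \<Rightarrow> real) set"
  where "hier_space N \<phi> = lin_span \<phi> {1..N}"

text \<open>
  \<open>n\<close> is the number of quadrature nodes, \<open>N\<close> the dimension of the space projected onto.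
\<close>

definition disc_proj ::
    "(real ^ 'n) set \<Rightarrow> nat \<Rightarrow> nat \<Rightarrow> (nat \<Rightarrow> real ^ 'n) \<Rightarrow> (nat \<Rightarrow> real ^ 'n \<Rightarrow> real) \<Rightarrow>
     (real ^ 'n \<Rightarrow> real) \<Rightarrow> real ^ 'n \<Rightarrow> real"
  where "disc_proj T n N x \<phi> v =
    (THE p. p \<in> hier_space N \<phi> \<and>
       (\<forall>w\<in>hier_space N \<phi>. disc_inner T n x \<phi> (\<lambda>y. v y - p y) w = 0))"

definition fluct ::
    "(real ^ 'n) set \<Rightarrow> nat \<Rightarrow> nat \<Rightarrow> (nat \<Rightarrow> real ^ 'n) \<Rightarrow> (nat \<Rightarrow> real ^ 'n \<Rightarrow> real) \<Rightarrow>
     (real ^ 'n \<Rightarrow> real) \<Rightarrow> real ^ 'n \<Rightarrow> real"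
  where "fluct T n N x \<phi> v = (\<lambda>y. v y - disc_proj T n N x \<phi> v y)"

definition fluct_vec ::
    "(real ^ 'n) set \<Rightarrow> nat \<Rightarrow> nat \<Rightarrow> (nat \<Rightarrow> real ^ 'n) \<Rightarrow> (nat \<Rightarrow> real ^ 'n \<Rightarrow> real) \<Rightarrow>
     (real ^ 'n \<Rightarrow> real ^ 'm) \<Rightarrow> real ^ 'n \<Rightarrow> real ^ 'm"
  where "fluct_vec T n N x \<phi> v = (\<lambda>y. \<chi> j. fluct T n N x \<phi> (\<lambda>z. v z $ j) y)"

definition gradient :: "(real ^ 'n \<Rightarrow> real) \<Rightarrow> real ^ 'n \<Rightarrow> real ^ 'n"
  where "gradient v y = (\<chi> j. frechet_derivative v (at y) (axis j 1))"

definition Linf_norm :: "(real ^ 'n) set \<Rightarrow> (real ^ 'n \<Rightarrow> real) \<Rightarrow> ereal"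
  where "Linf_norm T v = esssup (lebesgue_on T) (\<lambda>y. ereal \<bar>v y\<bar>)"

definition norm_on :: "('a \<Rightarrow> real) set \<Rightarrow> (('a \<Rightarrow> real) \<Rightarrow> real) \<Rightarrow> bool"
  where "norm_on V N \<longleftrightarrow>
    (\<forall>v\<in>V. 0 \<le> N v \<and> (N v = 0 \<longleftrightarrow> v = (\<lambda>y. 0))) \<and>
    (\<forall>v\<in>V. \<forall>c. N (\<lambda>y. c * v y) = \<bar>c\<bar> * N v) \<and>
    (\<forall>v\<in>V. \<forall>w\<in>V. N (\<lambda>y. v y + w y) \<le> N v + N w)"

definition linear_operator_on ::
    "('a::topological_space) set \<Rightarrow> ('a \<Rightarrow> real) set \<Rightarrow> (('a \<Rightarrow> real) \<Rightarrow> 'a \<Rightarrow> real) \<Rightarrow> bool"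
  where "linear_operator_on T V P \<longleftrightarrow>
    (\<forall>v. continuous_on T v \<longrightarrow> P v \<in> V) \<and>
    (\<forall>u v. continuous_on T u \<longrightarrow> continuous_on T v \<longrightarrow>
       P (\<lambda>y. u y + v y) = (\<lambda>y. P u y + P v y)) \<and>
    (\<forall>v c. continuous_on T v \<longrightarrow> P (\<lambda>y. c * v y) = (\<lambda>y. c * P v y))"

end

theory Submission
  imports Defs
begin

text \<open>
  Testing the defining orthogonality of \<open>P v\<close> with the Lagrange polynomials of the first nodes shows
  that \<open>P v\<close> interpolates \<open>v\<close> there, so \<open>P v\<close> is the sum of \<open>v (x\<^sub>i) \<phi>\<^sub>i\<close> over these nodes.  Linearity
  follows at once, and so does the stability bound: the essential supremum of a continuous function
  bounds it at every point of \<open>T\<close>, as \<open>T\<close> is the closure of its interior.  The fluctuation of \<open>v\<close> vanishes at the first nodes and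
  equals \<open>v\<close> at the remaining ones, so the discrete inner product in the third claim is a sum of
  terms \<open>(2m - 1) \<omega>\<^sub>i v (x\<^sub>i)\<^bsup>2m-2\<^esup> \<bar>\<nabla>v (x\<^sub>i)\<bar>\<^sup>2\<close>.
\<close>

lemma lin_span_sum_subset:
  assumes "finite I" "J \<subseteq> I"
  shows "(\<lambda>y. \<Sum>i\<in>J. c i * \<phi> i y) \<in> lin_span \<phi> I"
proof -
  have "(\<Sum>i\<in>J. c i * \<phi> i y) = (\<Sum>i\<in>I. (if i \<in> J then c i else 0) * \<phi> i y)" for y
    using assms by (intro sum.mono_neutral_cong_left) auto
  then show ?thesis
    unfolding lin_span_def by auto
qed

lemma lin_span_base:
  assumes "finite I" "i \<in> I"
  shows "\<phi> i \<in> lin_span \<phi> I"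
  using lin_span_sum_subset[of I "{i}" "\<lambda>_. 1" \<phi>] assms by simp

text \<open>Triangle inequality and homogeneity, by induction on \<open>J\<close>. The space on
  which \<open>N\<close> is a norm stays the span over \<open>I\<close> while \<open>J\<close>
  grows, so every partial sum remains in the domain of the norm axioms.\<close>

lemma norm_on_sum_le:
  assumes N: "norm_on (lin_span \<phi> I) N" and I: "finite I" and J: "J \<subseteq> I"
  shows "N (\<lambda>y. \<Sum>i\<in>J. c i * \<phi> i y) \<le> (\<Sum>i\<in>J. \<bar>c i\<bar> * N (\<phi> i))"
  using finite_subset[OF J I] J
proof (induction J rule: finite_induct)
  case empty
  have "(\<lambda>y. 0) \<in> lin_span \<phi> I"
    using lin_span_sum_subset[OF I, of "{}"] by simp
  then show ?case
    using N by (auto simp: norm_on_def)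
next
  case (insert a J)
  have "N (\<lambda>y. c a * \<phi> a y + (\<Sum>i\<in>J. c i * \<phi> i y))
      \<le> N (\<lambda>y. c a * \<phi> a y) + N (\<lambda>y. \<Sum>i\<in>J. c i * \<phi> i y)"
    using N lin_span_sum_subset[OF I, of "{a}" c \<phi>] lin_span_sum_subset[OF I, of J c \<phi>] insert.prems
    by (simp add: norm_on_def)
  also have "N (\<lambda>y. c a * \<phi> a y) = \<bar>c a\<bar> * N (\<phi> a)"
    using N lin_span_base[OF I, of a \<phi>] insert.prems by (simp add: norm_on_def)
  finally show ?case
    using insert by simp
qed

text \<open>By duality the Lagrange polynomials are orthogonal for the discrete inner product, with
  the weights as squared norms. Positivity of the weights gives the uniqueness that
  \<open>THE\<close> requires.\<close>

lemma disc_proj_eq: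
  assumes dual: "\<forall>i\<in>{1..n}. \<forall>j\<in>{1..n}. \<phi> i (x j) = (if i = j then 1 else 0)"
    and weights: "\<forall>i\<in>{1..n}. 0 < quad_weight T \<phi> i"
    and "N \<le> n"
  shows "disc_proj T n N x \<phi> v = (\<lambda>y. \<Sum>i=1..N. v (x i) * \<phi> i y)"
  unfolding disc_proj_def
proof (rule the_equality)
  have at_node: "(\<Sum>i=1..N. c i * \<phi> i (x j)) = (if j \<le> N then c j else 0)"
    if "j \<in> {1..n}" for c j
  proof -
    have "(\<Sum>i=1..N. c i * \<phi> i (x j)) = (\<Sum>i=1..N. if i = j then c i else 0)"
      using dual that \<open>N \<le> n\<close> by (intro sum.cong) auto
    then show ?thesis
      using that by simp
  qed
  show "(\<lambda>y. \<Sum>i=1..N. v (x i) * \<phi> i y) \<in> hier_space N \<phi> \<and>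
    (\<forall>w\<in>hier_space N \<phi>. disc_inner T n x \<phi> (\<lambda>y. v y - (\<Sum>i=1..N. v (x i) * \<phi> i y)) w = 0)"
  proof (intro conjI ballI)
    show "(\<lambda>y. \<Sum>i=1..N. v (x i) * \<phi> i y) \<in> hier_space N \<phi>"
      unfolding hier_space_def by (rule lin_span_sum_subset) simp_all
    fix w
    assume "w \<in> hier_space N \<phi>"
    then obtain c where w: "w = (\<lambda>y. \<Sum>i=1..N. c i * \<phi> i y)"
      by (auto simp: hier_space_def lin_span_def)
    \<comment> \<open>One factor vanishes at every node: the residual if \<open>j \<le> N\<close>,
      and \<open>w\<close> if \<open>j > N\<close>.\<close>
    have "(v (x j) - (\<Sum>i=1..N. v (x i) * \<phi> i (x j))) \<bullet> w (x j) = 0" if "j \<in> {1..n}" for j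
      unfolding w at_node[OF that] by simp
    then show "disc_inner T n x \<phi> (\<lambda>y. v y - (\<Sum>i=1..N. v (x i) * \<phi> i y)) w = 0"
      unfolding disc_inner_def by (intro sum.neutral) simp
  qed
  fix p
  assume p: "p \<in> hier_space N \<phi> \<and>
    (\<forall>w\<in>hier_space N \<phi>. disc_inner T n x \<phi> (\<lambda>y. v y - p y) w = 0)"
  then obtain c where c: "p = (\<lambda>y. \<Sum>i=1..N. c i * \<phi> i y)"
    by (auto simp: hier_space_def lin_span_def)
  have "c j = v (x j)" if j: "j \<in> {1..N}" for j
  proof -
    have "j \<in> {1..n}"
      using j \<open>N \<le> n\<close> by auto
    have pj: "p (x j) = c j"
      using at_node[OF \<open>j \<in> {1..n}\<close>, of c] j by (simp add: c)
    have "\<phi> j \<in> hier_space N \<phi>"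
      unfolding hier_space_def using j by (intro lin_span_base) auto
    \<comment> \<open>Testing with \<open>\<phi> j\<close> isolates the \<open>j\<close>-th summand,
      whose positive weight then cancels.\<close>
    then have "0 = disc_inner T n x \<phi> (\<lambda>y. v y - p y) (\<phi> j)"
      using p by simp
    also have "\<dots> = (\<Sum>i=1..n. if i = j then quad_weight T \<phi> i * (v (x i) - p (x i)) else 0)"
      unfolding disc_inner_def using dual \<open>j \<in> {1..n}\<close> by (intro sum.cong) auto
    also have "\<dots> = quad_weight T \<phi> j * (v (x j) - c j)"
      using \<open>j \<in> {1..n}\<close> by (simp add: pj)
    finally show ?thesis
      using bspec[OF weights \<open>j \<in> {1..n}\<close>] by simp
  qed
  then show "p = (\<lambda>y. \<Sum>i=1..N. v (x i) * \<phi> i y)"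
    by (simp add: c)
qed

lemma fluct_vec_at_node:
  assumes dual: "\<forall>i\<in>{1..n}. \<forall>j\<in>{1..n}. \<phi> i (x j) = (if i = j then 1 else 0)"
    and weights: "\<forall>i\<in>{1..n}. 0 < quad_weight T \<phi> i"
    and "N \<le> n" and j: "j \<in> {1..n}"
  shows "fluct_vec T n N x \<phi> v (x j) = (if j \<le> N then 0 else v (x j))"
proof -
  have "(\<Sum>i=1..N. v (x i) $ l * \<phi> i (x j)) = (\<Sum>i=1..N. if i = j then v (x i) $ l else 0)" for l
    using dual j \<open>N \<le> n\<close> by (intro sum.cong) auto
  then show ?thesis
    using j by (simp add: vec_eq_iff fluct_vec_def fluct_def disc_proj_eq[OF dual weights \<open>N \<le> n\<close>])
qed

text \<open>The points of the interior where the bound fails form an open null set, hence none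
  exist. The bound then passes from the interior to its closure by continuity; the second assumption
  on \<open>T\<close> excludes lower-dimensional pieces, which the essential supremum cannot
  see.\<close>

lemma abs_le_Linf_norm:
  fixes T :: "(real ^ 'n) set"
  assumes T: "T \<in> sets lebesgue" "T \<subseteq> closure (interior T)"
    and v: "continuous_on T v" and z: "z \<in> T"
  shows "ereal \<bar>v z\<bar> \<le> Linf_norm T v"
proof -
  define f where "f = (\<lambda>y. ereal \<bar>v y\<bar>)"
  define E where "E = Linf_norm T v"
  have f: "continuous_on T f"
    unfolding f_def using v by (intro continuous_intros)
  have "AE y in lebesgue_on T. f y \<le> E"
    unfolding E_def Linf_norm_def f_def[symmetric] by (rule esssup_AE)
  then have "AE y in lebesgue. y \<in> T \<longrightarrow> f y \<le> E"
    using T by (simp add: AE_restrict_space_iff)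
  then have "AE y in lebesgue. y \<notin> interior T \<inter> f -` {E<..}"
    by eventually_elim (use interior_subset in \<open>auto simp: not_less\<close>)
  moreover have "open (interior T \<inter> f -` {E<..})"
    using continuous_on_subset[OF f interior_subset] by (intro continuous_open_preimage) auto
  moreover from this have "interior T \<inter> f -` {E<..} \<in> sets lebesgue"
    by simp
  ultimately have "negligible (interior T \<inter> f -` {E<..})" "open (interior T \<inter> f -` {E<..})"
    unfolding negligible_iff_null_sets by (simp_all only: AE_iff_null_sets)
  then have "interior T \<inter> f -` {E<..} = {}"
    using open_not_negligible by blast
  \<comment> \<open>Since \<open>v\<close> is continuous only on \<open>T\<close>, the sublevel set
    is closed relative to \<open>T\<close>. It is the trace of a closed set \<open>A\<close> of the
    whole space, to which minimality of the closure applies.\<close>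
  moreover obtain A where "closed A" and A: "A \<inter> T = f -` {..E} \<inter> T"
    using f closed_atMost unfolding continuous_on_closed_invariant by metis
  ultimately have "interior T \<subseteq> A"
    using interior_subset[of T] by (auto simp: set_eq_iff not_less)
  then have "z \<in> A"
    using closure_minimal[OF _ \<open>closed A\<close>] T z by blast
  then have "f z \<le> E"
    using A z by blast
  then show ?thesis
    by (simp add: E_def f_def)
qed

lemma affine_image_ref_cube:
  fixes F :: "real ^ 'n \<Rightarrow> real ^ 'n"
  assumes "affine_iso F"
  shows "compact (F ` ref_cube)" "F ` ref_cube \<subseteq> closure (interior (F ` ref_cube))"
proof -
  obtain L b where L: "linear L" "bij L" and F: "F = (\<lambda>y. L y + b)"
    using assms by (auto simp: affine_iso_def)
  have im: "F ` S = (+) b ` L ` S" for S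
    by (auto simp: F image_image add.commute)
  have "continuous_on ref_cube L"
    using L(1) by (simp add: linear_continuous_on linear_conv_bounded_linear)
  then have "compact (L ` ref_cube)"
    by (rule compact_continuous_image) (simp add: ref_cube_def)
  then show "compact (F ` ref_cube)"
    unfolding im by (rule compact_translation)
  \<comment> \<open>A convex set with nonempty interior has the same closure as its interior; the
    centre of the cube supplies an interior point.\<close>
  have "convex (F ` ref_cube)"
    unfolding im using L(1) by (simp add: convex_linear_image convex_translation ref_cube_def)
  moreover have "interior (F ` ref_cube) \<noteq> {}"
  proof -
    have "(0::real ^ 'n) \<in> interior ref_cube"
      by (simp add: ref_cube_def interior_cbox mem_box_cart)
    then have "interior (L ` ref_cube) \<noteq> {}"
      using interior_bijective_linear_image[OF L] by auto
    then show ?thesis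
      by (simp add: im interior_translation)
  qed
  ultimately have "closure (interior (F ` ref_cube)) = closure (F ` ref_cube)"
    by (rule convex_closure_interior)
  then show "F ` ref_cube \<subseteq> closure (interior (F ` ref_cube))"
    by (simp add: closure_subset)
qed

lemma tensor_grid_subset_ref_cube:
  assumes "tensor_grid k G"
  shows "G \<subseteq> ref_cube"
  using assms by (fastforce simp: tensor_grid_def ref_cube_def mem_box_cart image_subset_iff)

text \<open>A polynomial composed with the affine inverse of \<open>F\<close> is smooth on the whole
  space. Hence \<open>gradient\<close>, which uses a full neighbourhood, is meaningful also at nodes
  on the boundary of the element.\<close>

lemma Q_elem_differentiable:
  fixes F :: "real ^ 'n \<Rightarrow> real ^ 'n"
  assumes "affine_iso F" "v \<in> Q_elem F k"
  shows "v differentiable (at y)"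
proof -
  obtain L b where L: "linear L" "bij L" and F: "F = (\<lambda>y. L y + b)"
    using assms(1) by (auto simp: affine_iso_def)
  obtain u where u: "u \<in> Q_ref k" and v: "v = u \<circ> inv F"
    using assms(2) by (auto simp: Q_elem_def)
  have "linear (inv L)"
    using L by (simp add: inj_linear_imp_inv_linear bij_is_inj)
  then have "(\<lambda>z. inv L (z - b)) differentiable (at y)"
    by (rule differentiable_compose[OF linear_imp_differentiable]) simp
  moreover have "inv F = (\<lambda>z. inv L (z - b))"
    unfolding F using L by (intro inv_equality) (simp_all add: bij_is_surj surj_f_inv_f bij_is_inj)
  ultimately have invF: "inv F differentiable (at y)"
    by simp
  have monomial: "(\<lambda>y. \<Prod>j\<in>J. (y $ j) ^ \<alpha> j) differentiable (at z)"
    for z :: "real ^ 'n" and J and \<alpha> :: "'n \<Rightarrow> nat"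
    by (induction J rule: infinite_finite_induct)
      (simp_all add: bounded_linear_imp_differentiable[OF bounded_linear_vec_nth])
  have "u differentiable (at z)" for z
  proof -
    let ?I = "{\<alpha> :: 'n \<Rightarrow> nat. \<forall>j. \<alpha> j \<le> k}"
    obtain c where "u = (\<lambda>y. \<Sum>\<alpha>\<in>?I. c \<alpha> * (\<Prod>j\<in>UNIV. (y $ j) ^ \<alpha> j))"
      using u by (auto simp: Q_ref_def lin_span_def)
    then show ?thesis
      \<comment> \<open>a sum over an infinite set is \<open>0\<close>, so finiteness of the index set need not be shown\<close>
      by (cases "finite ?I") (simp_all add: monomial)
  qed
  then show ?thesis
    unfolding v by (intro differentiable_chain_at invF)
qed

text \<open>The chain rule. For \<open>p = 0\<close> the truncated exponent is harmless because the
  factor \<open>real p\<close> vanishes.\<close>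

lemma gradient_power:
  assumes "v differentiable (at y)"
  shows "gradient (\<lambda>z. v z ^ p) y = (real p * v y ^ (p - 1)) *\<^sub>R gradient v y"
proof -
  have "(v has_derivative frechet_derivative v (at y)) (at y)"
    using assms by (simp add: frechet_derivative_works)
  then have "((\<lambda>z. v z ^ p) has_derivative
      (\<lambda>h. real p * frechet_derivative v (at y) h * v y ^ (p - 1))) (at y)"
    by (rule has_derivative_power)
  then have "frechet_derivative (\<lambda>z. v z ^ p) (at y) =
      (\<lambda>h. real p * frechet_derivative v (at y) h * v y ^ (p - 1))"
    by (rule frechet_derivative_at[symmetric])
  then show ?thesis
    by (simp add: gradient_def vec_eq_iff)
qed

theorem lemma13:
  fixes F :: "real ^ 'n \<Rightarrow> real ^ 'n"
    and T :: "(real ^ 'n) set"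
    and K k nK nk :: nat
    and G :: "(real ^ 'n) set"
    and x :: "nat \<Rightarrow> real ^ 'n"
    and \<phi> \<psi> :: "nat \<Rightarrow> real ^ 'n \<Rightarrow> real"
  assumes F: "affine_iso F"
    and T: "T = F ` ref_cube"
    and Kk: "K \<le> k"
    and nk: "nk = (k + 1) ^ CARD('n)"
    and nK: "nK = (K + 1) ^ CARD('n)"
    and grid: "tensor_grid k G"
    and nodes: "bij_betw x {1..nk} (F ` G)"
    and basis_k: "lagrange_basis (Q_elem F k) nk x \<phi>"
    and basis_K: "lagrange_basis (Q_elem F K) nK x \<psi>"
    and weights: "\<forall>i\<in>{1..nk}. 0 < quad_weight T \<phi> i"
  shows "linear_operator_on T (hier_space nK \<phi>) (disc_proj T nk nK x \<phi>)
    \<and> (\<forall>N. norm_on (hier_space nK \<phi>) N \<longrightarrow>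
         (\<exists>C::real. \<forall>v. continuous_on T v \<longrightarrow>
            ereal (N (disc_proj T nk nK x \<phi> v)) \<le> ereal C * Linf_norm T v))
    \<and> (\<forall>m::nat. 1 \<le> m \<longrightarrow> (\<forall>v\<in>Q_elem F k.
         0 \<le> disc_inner T nk x \<phi>
               (fluct_vec T nk nK x \<phi> (gradient v))
               (fluct_vec T nk nK x \<phi> (gradient (\<lambda>y. v y ^ (2 * m - 1))))))"
proof (intro conjI allI impI ballI)
  have dual: "\<forall>i\<in>{1..nk}. \<forall>j\<in>{1..nk}. \<phi> i (x j) = (if i = j then 1 else 0)"
    using basis_k by (simp add: lagrange_basis_def)
  have le: "nK \<le> nk"
    unfolding nK nk using Kk by (intro power_mono) auto
  note proj = disc_proj_eq[OF dual weights le]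
  note fluct = fluct_vec_at_node[OF dual weights le]
  show "linear_operator_on T (hier_space nK \<phi>) (disc_proj T nk nK x \<phi>)"
    unfolding linear_operator_on_def proj hier_space_def
    by (auto simp: distrib_right sum.distrib sum_distrib_left mult.assoc intro!: lin_span_sum_subset)
  show "\<exists>C. \<forall>v. continuous_on T v \<longrightarrow>
      ereal (N (disc_proj T nk nK x \<phi> v)) \<le> ereal C * Linf_norm T v"
    if "norm_on (hier_space nK \<phi>) N" for N
  \<comment> \<open>The constant stays schematic until the last line, where it becomes the sum of
    the norms \<open>N (\<phi> i)\<close>; being introduced before \<open>v\<close>, it cannot
    depend on it.\<close>
  proof (intro exI allI impI)
    fix v :: "real ^ 'n \<Rightarrow> real"
    assume v: "continuous_on T v"
    have N: "norm_on (lin_span \<phi> {1..nK}) N"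
      using that by (simp add: hier_space_def)
    have nonneg: "0 \<le> N (\<phi> i)" if "i \<in> {1..nK}" for i
      using N lin_span_base[OF _ that, of \<phi>] by (simp add: norm_on_def)
    have bound: "ereal \<bar>v (x i)\<bar> \<le> Linf_norm T v" if "i \<in> {1..nK}" for i
    proof (rule abs_le_Linf_norm[OF _ _ v])
      show "T \<in> sets lebesgue" "T \<subseteq> closure (interior T)"
        unfolding T using affine_image_ref_cube[OF F] by (auto dest: lmeasurable_compact)
      show "x i \<in> T"
        using bij_betwE[OF nodes, THEN bspec, of i] that le tensor_grid_subset_ref_cube[OF grid]
        by (auto simp: T)
    qed
    have "ereal (N (disc_proj T nk nK x \<phi> v)) \<le> ereal (\<Sum>i=1..nK. \<bar>v (x i)\<bar> * N (\<phi> i))"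
      unfolding proj using norm_on_sum_le[OF N] by simp
    also have "\<dots> = (\<Sum>i=1..nK. ereal (N (\<phi> i)) * ereal \<bar>v (x i)\<bar>)"
      by (simp add: mult.commute)
    also have "\<dots> \<le> (\<Sum>i=1..nK. ereal (N (\<phi> i)) * Linf_norm T v)"
      using nonneg bound by (intro sum_mono ereal_mult_left_mono) auto
    \<comment> \<open>Distributivity with an arbitrary extended real factor relies on the summands
      being nonnegative.\<close>
    also have "\<dots> = (\<Sum>i=1..nK. ereal (N (\<phi> i))) * Linf_norm T v"
      using nonneg by (intro sum_ereal_left_distrib[symmetric]) auto
    finally show "ereal (N (disc_proj T nk nK x \<phi> v)) \<le> ereal (\<Sum>i=1..nK. N (\<phi> i)) * Linf_norm T v"
      by simp
  qed
  fix m :: nat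
  \<comment> \<open>The exponent left after differentiation is even; with the factor 2 on the right,
    \<open>power_mult\<close> turns the power into a visible square.\<close>
  have exponent: "2 * m - 1 - 1 = (m - 1) * 2"
    by simp
  fix v :: "real ^ 'n \<Rightarrow> real"
  assume "v \<in> Q_elem F k"
  then have "gradient (\<lambda>y. v y ^ (2 * m - 1)) y
      = (real (2 * m - 1) * (v y ^ (m - 1))\<^sup>2) *\<^sub>R gradient v y" for y
    using gradient_power[OF Q_elem_differentiable[OF F, of v k y], of "2 * m - 1"]
    by (simp only: exponent power_mult)
  then show "0 \<le> disc_inner T nk x \<phi>
      (fluct_vec T nk nK x \<phi> (gradient v))
      (fluct_vec T nk nK x \<phi> (gradient (\<lambda>y. v y ^ (2 * m - 1))))"
    unfolding disc_inner_def using weights by (intro sum_nonneg) (simp add: fluct less_imp_le)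
qed

end
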